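(* Let $T$ be a tree on at least two vertices with $T \notin \mathcal{T}$. Then $\chi_{td}(T) = \gamma_t(T)+1$ if and only if there exist a minimum total dominating set $D$ of $T$ and a partition $(D_1,D_2)$ of $D$ (i.e. $D = D_1\cup D_2$, $D_1\cap D_2=\emptyset$) such that: (a) $D_2 \subseteq D_I$, where $D_I=\{u\in D : |\mathrm{pn}(u,D)|=1\}$; (b) $T$ contains no vertex $v$ with $|N_T(v)\cap D|\ge 2$ and $N_T(v)\cap D\subseteq D_2$; (c) the set $V(T)\setminus (D_1\cup N[S])$ is independent, where $S=\bigcup_{v\in D_2}\mathrm{pn}(v,D)$ and $N[S]=\bigcup_{s\in S}N_T[s]$.
   Context: All graphs are finite, simple, undirected and have no isolated vertices. A vertex $u$ totally dominates $w\neq u$ if $uw$ is an edge. A total dominating set (TD-set) of $G$ is a set $D\subseteq V(G)$ such that every vertex of $G$ has a neighbour in $D$; $\gamma_t(G)$ is the minimum size of a TD-set. A total dominator coloring (TD-coloring) of $G$ is a proper vertex coloring such that every vertex is adjacent to all vertices of some color class (necessarily different from its own); $\chi_{td}(G)$ is the minimum number of colors in a TD-coloring. For a TD-set $D$ and $u\in D$, the $D$-private neighbourhood is $\mathrm{pn}(u,D)=\{w\in V : N(w)\cap D=\{u\}\}$. A leaf is a vertex of degree 1 and a support vertex (stem) is a neighbour of a leaf. The family $\mathcal{T}$ consists of $P_2$ together with all trees obtained from $k\ge 1$ disjoint stars, each of order at least three, by adding $k-1$ edges joining leaf vertices of the stars so that the center of each original star remains a support vertex. *)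

theory Defs
  imports "Graph_Theory.Graph_Theory"
begin

text \<open>
  Finite simple undirected graphs are represented by \<open>pair_graph\<close>: a finite vertex set with a
  finite, symmetric, irreflexive arc relation, so that an edge \<open>uv\<close> is the pair of arcs
  \<open>(u, v)\<close> and \<open>(v, u)\<close>.
\<close>

definition nbhd :: "'a pair_pre_digraph \<Rightarrow> 'a \<Rightarrow> 'a set" where
  "nbhd G v = {w \<in> pverts G. (v, w) \<in> parcs G}"

definition closed_nbhd :: "'a pair_pre_digraph \<Rightarrow> 'a \<Rightarrow> 'a set" where
  "closed_nbhd G v = insert v (nbhd G v)"

text \<open>
  The predicates \<open>forest\<close> and \<open>tree\<close> of \<open>Digraph_Component\<close> are not usable here: in a symmetric
  digraph every edge gives a directed cycle of length two. The cycles of the undirected graph are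
  the directed cycles of length at least three.
\<close>

definition undirected_tree :: "'a pair_pre_digraph \<Rightarrow> bool" where
  "undirected_tree G \<longleftrightarrow> pair_graph G \<and> Digraph_Component.connected (with_proj G) \<and>
     \<not> (\<exists>p. pre_digraph.cycle (with_proj G) p \<and> 3 \<le> length p)"

definition td_set :: "'a pair_pre_digraph \<Rightarrow> 'a set \<Rightarrow> bool" where
  "td_set G D \<longleftrightarrow> D \<subseteq> pverts G \<and> (\<forall>v \<in> pverts G. nbhd G v \<inter> D \<noteq> {})"

definition total_domination_number :: "'a pair_pre_digraph \<Rightarrow> nat" where
  "total_domination_number G = (LEAST n. \<exists>D. td_set G D \<and> card D = n)"

definition minimum_td_set :: "'a pair_pre_digraph \<Rightarrow> 'a set \<Rightarrow> bool" where
  "minimum_td_set G D \<longleftrightarrow> td_set G D \<and> card D = total_domination_number G"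

definition proper_coloring :: "'a pair_pre_digraph \<Rightarrow> ('a \<Rightarrow> nat) \<Rightarrow> bool" where
  "proper_coloring G c \<longleftrightarrow> (\<forall>(u, v) \<in> parcs G. c u \<noteq> c v)"

definition color_class :: "'a pair_pre_digraph \<Rightarrow> ('a \<Rightarrow> nat) \<Rightarrow> nat \<Rightarrow> 'a set" where
  "color_class G c i = {v \<in> pverts G. c v = i}"

text \<open>
  Only the colors in \<open>c ` pverts G\<close> count, so color classes are nonempty and no vertex is
  vacuously adjacent to all vertices of an unused color.
\<close>

definition td_coloring :: "'a pair_pre_digraph \<Rightarrow> ('a \<Rightarrow> nat) \<Rightarrow> bool" where
  "td_coloring G c \<longleftrightarrow> proper_coloring G c \<and>
     (\<forall>v \<in> pverts G. \<exists>i \<in> c ` pverts G. color_class G c i \<subseteq> nbhd G v)"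

definition td_chromatic_number :: "'a pair_pre_digraph \<Rightarrow> nat" where
  "td_chromatic_number G = (LEAST n. \<exists>c. td_coloring G c \<and> card (c ` pverts G) = n)"

definition private_nbhd :: "'a pair_pre_digraph \<Rightarrow> 'a \<Rightarrow> 'a set \<Rightarrow> 'a set" where
  "private_nbhd G u D = {w \<in> pverts G. nbhd G w \<inter> D = {u}}"

definition independent_set :: "'a pair_pre_digraph \<Rightarrow> 'a set \<Rightarrow> bool" where
  "independent_set G X \<longleftrightarrow> X \<subseteq> pverts G \<and> (\<forall>u \<in> X. \<forall>v \<in> X. (u, v) \<notin> parcs G)"

definition leaf :: "'a pair_pre_digraph \<Rightarrow> 'a \<Rightarrow> bool" where
  "leaf G v \<longleftrightarrow> v \<in> pverts G \<and> card (nbhd G v) = 1"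

definition support_vertex :: "'a pair_pre_digraph \<Rightarrow> 'a \<Rightarrow> bool" where
  "support_vertex G v \<longleftrightarrow> v \<in> pverts G \<and> (\<exists>w \<in> nbhd G v. leaf G w)"

definition is_P2 :: "'a pair_pre_digraph \<Rightarrow> bool" where
  "is_P2 G \<longleftrightarrow> (\<exists>u v. u \<noteq> v \<and> G = \<lparr>pverts = {u, v}, parcs = {(u, v), (v, u)}\<rparr>)"

definition star_with_center :: "'a pair_pre_digraph \<Rightarrow> 'a \<Rightarrow> bool" where
  "star_with_center G z \<longleftrightarrow> finite (pverts G) \<and> z \<in> pverts G \<and>
     parcs G = {z} \<times> (pverts G - {z}) \<union> (pverts G - {z}) \<times> {z}"

text \<open>
  \<open>F\<close> is the set of added edges, as two-element sets. A leaf of a star may lie on several added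
  edges; since the result is a tree, every added edge joins two different stars. The family is
  closed under isomorphism because the stars range over all graphs on the vertex type.
\<close>

definition star_family :: "'a pair_pre_digraph set" where
  "star_family = {T. is_P2 T \<or>
     (undirected_tree T \<and>
      (\<exists>(k::nat) St z F. k \<ge> 1 \<and>
         (\<forall>i<k. star_with_center (St i) (z i) \<and> card (pverts (St i)) \<ge> 3) \<and>
         (\<forall>i<k. \<forall>j<k. i \<noteq> j \<longrightarrow> pverts (St i) \<inter> pverts (St j) = {}) \<and>
         (\<forall>e\<in>F. \<exists>a b. a \<noteq> b \<and> e = {a, b} \<and>
            (\<exists>i<k. leaf (St i) a) \<and> (\<exists>j<k. leaf (St j) b)) \<and>
         card F = k - 1 \<and>
         T = \<lparr>pverts = (\<Union>i<k. pverts (St i)),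
              parcs = (\<Union>i<k. parcs (St i)) \<union> {(a, b). {a, b} \<in> F}\<rparr> \<and>
         (\<forall>i<k. support_vertex T (z i))))}"

end

theory Submission
  imports Defs
begin

text \<open>
  Representatives of the color classes of a TD-coloring form a TD-set, so \<open>\<gamma>\<^sub>t \<le> \<chi>\<^sub>t\<^sub>d\<close>.

  Given \<open>D1\<close> and \<open>D2\<close>, make every vertex of \<open>D1\<close> a color class, give the uncolored neighbours of
  the unique private neighbour of \<open>u \<in> D2\<close> the color of \<open>u\<close>, and use one more color for the rest;
  that extra class is independent also with the vertices of \<open>S\<close> added, as their neighbours are
  already colored. Conversely, if some class of a coloring with \<open>\<gamma>\<^sub>t + 1\<close> colors is not needed for
  domination, representatives of the other classes form \<open>D\<close>, with \<open>D1\<close> given by the singleton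
  classes: a larger class lies in the neighbourhood of at most one vertex, there being no 4-cycle.

  If \<open>\<chi>\<^sub>t\<^sub>d = \<gamma>\<^sub>t\<close>, no representative can be dropped from any choice of representatives. This forces
  the singleton classes to be the support vertices and the neighbourhood of each support vertex to
  be a class. The vertices without a support vertex in their closed neighbourhood induce
  minimum degree two, so there are none, and the stars around the support vertices partition
  the tree.
\<close>

section \<open>Adjacency, connectedness and acyclicity of the tree\<close>

locale undirected_tree_graph =
  fixes T :: "'a pair_pre_digraph"
  assumes tree: "undirected_tree T"
    and card_V: "card (pverts T) \<ge> 2"
begin

abbreviation "V \<equiv> pverts T"
abbreviation "N \<equiv> nbhd T"

lemma pair_graph: "pair_graph T"
  using tree by (simp add: undirected_tree_def)

lemma finite_V [simp]: "finite V"
  using pair_graph by (simp add: pair_graph_def pair_digraph_def pair_fin_digraph_def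
      pair_fin_digraph_axioms_def)

lemma arc_in_V:
  assumes "(x, y) \<in> parcs T"
  shows "x \<in> V" "y \<in> V"
proof -
  interpret pair_graph T by (rule pair_graph)
  show "x \<in> V" "y \<in> V" using assms by (auto dest: wellformed')
qed

lemma arc_sym: "(x, y) \<in> parcs T \<Longrightarrow> (y, x) \<in> parcs T"
proof -
  interpret pair_graph T by (rule pair_graph)
  show "(x, y) \<in> parcs T \<Longrightarrow> (y, x) \<in> parcs T"
    using pair_sym_arcs by (auto simp: symmetric_def elim: symE)
qed

lemma mem_N [simp]: "y \<in> N x \<longleftrightarrow> (x, y) \<in> parcs T"
  by (auto simp: nbhd_def dest: arc_in_V)

lemma arc_irrefl [simp]: "(x, x) \<notin> parcs T"
proof -
  interpret pair_graph T by (rule pair_graph)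
  show ?thesis using pair_no_loops by fastforce
qed

lemma V_nonempty: "V \<noteq> {}"
proof -
  have "verts (mk_symmetric (with_proj T)) \<noteq> {}"
    using tree by (auto simp: undirected_tree_def connected_def strongly_connected_def)
  then show ?thesis by simp
qed

text \<open>Without such an arc, an induction along reachability from a vertex of \<open>S\<close>
  would never leave \<open>S\<close>, against connectedness.\<close>

lemma crossing_arc:
  assumes "S \<subseteq> V" "S \<noteq> {}" "S \<noteq> V"
  obtains x y where "x \<in> S" "y \<in> V - S" "(x, y) \<in> parcs T"
proof -
  interpret pair_graph T by (rule pair_graph)
  obtain r v where rv: "r \<in> S" "v \<in> V" "v \<notin> S" using assms by auto
  have "r \<rightarrow>\<^sup>*\<^bsub>with_proj (mk_symmetric T)\<^esub> v"
    using tree rv assms(1) by (auto simp: undirected_tree_def connected_def strongly_connected_def)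
  then have "r \<rightarrow>\<^sup>*\<^bsub>with_proj T\<^esub> v"
    using reachable_mk_symmetric_eq pair_sym_arcs by (simp add: symmetric_def)
  then have "v \<in> S \<or> (\<exists>x\<in>S. \<exists>y\<in>V - S. (x, y) \<in> parcs T)"
  proof (induction rule: reachable_induct)
    case base
    then show ?case using rv by simp
  next
    case (step x y)
    then show ?case by (auto dest: wellformed')
  qed
  then show ?thesis using rv that by auto
qed

lemma awalk_vwalk_arcs:
  assumes "successively (\<lambda>x y. (x, y) \<in> parcs T) vs" "vs \<noteq> []"
  shows "set (vwalk_arcs vs) \<subseteq> parcs T" "pcas (hd vs) (vwalk_arcs vs) (last vs)"
    "pawalk_verts (hd vs) (vwalk_arcs vs) = vs"
  using assms by (induction vs rule: vwalk_arcs.induct) auto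

text \<open>Acyclicity in terms of vertex lists: \<open>y\<close> closes the path to a cycle with
  \<open>length xs + 1\<close> arcs, and the bound on \<open>length xs\<close> makes this at least
  three.\<close>

lemma no_closed_path:
  assumes "successively (\<lambda>x y. (x, y) \<in> parcs T) xs" "distinct xs" "length xs \<ge> 2"
    and "y \<notin> set xs" "(y, hd xs) \<in> parcs T" "(last xs, y) \<in> parcs T"
  shows False
proof -
  let ?vs = "y # xs @ [y]"
  have ne: "xs \<noteq> []" using assms(3) by auto
  have suc: "successively (\<lambda>x y. (x, y) \<in> parcs T) ?vs"
    using assms ne by (auto simp: successively_append_iff successively_Cons)
  note w = awalk_vwalk_arcs[OF suc, simplified]
  have "pre_digraph.awalk (with_proj T) y (vwalk_arcs ?vs) y"
    using w assms(5) by (auto simp: pre_digraph.awalk_def cas_with_proj_eq dest: arc_in_V)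
  moreover have "distinct (tl (pre_digraph.awalk_verts (with_proj T) y (vwalk_arcs ?vs)))"
    using w assms(2,4) by (simp add: awalk_verts_with_proj_eq)
  moreover have len: "length (vwalk_arcs ?vs) = Suc (length xs)"
    using arg_cong[OF w(3), of length] pre_digraph.length_awalk_verts[of "with_proj T" y "vwalk_arcs ?vs"]
    by (simp add: awalk_verts_with_proj_eq)
  moreover have "vwalk_arcs ?vs \<noteq> []" using len by auto
  ultimately have "pre_digraph.cycle (with_proj T) (vwalk_arcs ?vs)"
    unfolding pre_digraph.cycle_def by blast
  moreover have "3 \<le> length (vwalk_arcs ?vs)" using len assms(3) by simp
  ultimately show False using tree by (auto simp: undirected_tree_def)
qed

subsection \<open>Rooted trees\<close>

text \<open>\<open>d\<close> is the depth below the root \<open>r\<close> and \<open>p\<close> the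
  parent map. Acyclicity is encoded in the last clause: every arc inside \<open>S\<close> joins a
  vertex to its parent.\<close>

definition rooted :: "'a set \<Rightarrow> 'a \<Rightarrow> ('a \<Rightarrow> nat) \<Rightarrow> ('a \<Rightarrow> 'a) \<Rightarrow> bool" where
  "rooted S r d p \<longleftrightarrow> d r = 0 \<and> r \<in> S \<and>
     (\<forall>v\<in>S - {r}. p v \<in> S \<and> (v, p v) \<in> parcs T \<and> d v = Suc (d (p v))) \<and>
     (\<forall>x\<in>S. \<forall>y\<in>S. (x, y) \<in> parcs T \<longrightarrow> y \<noteq> r \<and> x = p y \<or> x \<noteq> r \<and> y = p x)"

definition path_in :: "'a set \<Rightarrow> 'a \<Rightarrow> 'a \<Rightarrow> 'a list \<Rightarrow> bool" where
  "path_in S x y xs \<longleftrightarrow> xs \<noteq> [] \<and> hd xs = x \<and> last xs = y \<and> distinct xs \<and> set xs \<subseteq> S \<and>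
     successively (\<lambda>x y. (x, y) \<in> parcs T) xs"

lemma path_in_rev: "path_in S x y xs \<Longrightarrow> path_in S y x (rev xs)"
  unfolding path_in_def
  by (auto simp: hd_rev last_rev intro: arc_sym elim!: successively_mono)

lemma path_in_snoc:
  assumes "path_in S x y xs" "z \<notin> S" "(y, z) \<in> parcs T"
  shows "path_in (insert z S) x z (xs @ [z])"
  using assms unfolding path_in_def by (auto simp: successively_append_iff)

text \<open>\<open>S\<close> grows from \<open>{r}\<close> by one vertex \<open>y\<close> at a time,
  hung below the end \<open>x\<close> of an arc leaving \<open>S\<close>. The paths inside
  \<open>S\<close> are carried along to show that \<open>y\<close> has no other neighbour in
  \<open>S\<close>: a path from \<open>x\<close> to a second one would close a cycle through
  \<open>y\<close>.\<close>

lemma rooted_subset_exists: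
  assumes r: "r \<in> V" and "n < card V"
  shows "\<exists>S d p. S \<subseteq> V \<and> card S = Suc n \<and> rooted S r d p \<and>
    (\<forall>x\<in>S. \<forall>y\<in>S. \<exists>xs. path_in S x y xs)"
  using assms(2)
proof (induction n)
  case 0
  have "path_in {r} r r [r]" by (simp add: path_in_def)
  then have "rooted {r} r (\<lambda>_. 0) id \<and> (\<forall>x\<in>{r}. \<forall>y\<in>{r}. \<exists>xs. path_in {r} x y xs)"
    by (auto simp: rooted_def)
  then show ?case using r by (intro exI[of _ "{r}"]) auto
next
  case (Suc n)
  then obtain S d p where S: "S \<subseteq> V" "card S = Suc n" "rooted S r d p"
    and P: "\<And>x y. x \<in> S \<Longrightarrow> y \<in> S \<Longrightarrow> \<exists>xs. path_in S x y xs" by auto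
  have "finite S" using S(1) finite_V finite_subset by blast
  have "S \<noteq> {}" "S \<noteq> V" using S(2) Suc.prems by auto
  then obtain x y where xy: "x \<in> S" "y \<in> V - S" "(x, y) \<in> parcs T"
    using crossing_arc[OF S(1)] by blast
  have uniq: "x' = x" if x': "x' \<in> S" "(x', y) \<in> parcs T" for x'
  proof (rule ccontr)
    assume "x' \<noteq> x"
    obtain xs where xs: "path_in S x x' xs" using P xy(1) x'(1) by blast
    have "length xs \<ge> 2"
      using xs \<open>x' \<noteq> x\<close> by (cases xs; cases "tl xs") (auto simp: path_in_def)
    then show False
      using xs xy x' no_closed_path[of xs y] by (auto simp: path_in_def intro: arc_sym)
  qed
  let ?S = "insert y S"
  let ?d = "d(y := Suc (d x))" and ?p = "p(y := x)"
  have ry: "r \<in> S" "y \<noteq> r" "y \<notin> S" "d r = 0" using S(3) xy by (auto simp: rooted_def)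
  have up: "?p v \<in> ?S \<and> (v, ?p v) \<in> parcs T \<and> ?d v = Suc (?d (?p v))" if "v \<in> ?S - {r}" for v
  proof (cases "v = y")
    case True
    then show ?thesis using xy ry arc_sym[OF xy(3)] by auto
  next
    case False
    then have "p v \<in> S \<and> (v, p v) \<in> parcs T \<and> d v = Suc (d (p v))"
      using S(3) that unfolding rooted_def by blast
    moreover from this have "p v \<noteq> y" using ry by metis
    ultimately show ?thesis using False by simp
  qed
  have arcs: "b \<noteq> r \<and> a = ?p b \<or> a \<noteq> r \<and> b = ?p a"
    if ab: "a \<in> ?S" "b \<in> ?S" "(a, b) \<in> parcs T" for a b
  proof -
    consider "a = y" "b \<in> S" | "b = y" "a \<in> S" | "a \<in> S" "b \<in> S"
      using ab arc_irrefl by blast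
    then show ?thesis
    proof cases
      case 1
      then show ?thesis using uniq[of b] arc_sym[OF ab(3)] ry by auto
    next
      case 2
      then show ?thesis using uniq[of a] ab(3) ry by auto
    next
      case 3
      then have "b \<noteq> r \<and> a = p b \<or> a \<noteq> r \<and> b = p a"
        using S(3) ab(3) unfolding rooted_def by blast
      moreover have "a \<noteq> y" "b \<noteq> y" using 3 ry by auto
      ultimately show ?thesis by simp
    qed
  qed
  have "rooted ?S r ?d ?p"
    unfolding rooted_def using up arcs ry by (metis fun_upd_other insertCI)
  moreover have "\<exists>xs. path_in ?S a b xs" if ab: "a \<in> ?S" "b \<in> ?S" for a b
  proof -
    have mono: "path_in S a b xs \<Longrightarrow> path_in ?S a b xs" for a b xs by (auto simp: path_in_def)
    have to_y: "\<exists>xs. path_in ?S a y xs" if "a \<in> S" for a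
      using P[OF that xy(1)] path_in_snoc xy by blast
    have "path_in ?S y y [y]" by (simp add: path_in_def)
    then show ?thesis using ab P mono to_y path_in_rev by (metis insertE)
  qed
  moreover have "card ?S = Suc (Suc n)" "?S \<subseteq> V" using S xy \<open>finite S\<close> by auto
  ultimately show ?case by blast
qed

lemma rooting:
  assumes "r \<in> V"
  obtains d p where "rooted V r d p"
proof -
  have "card V - 1 < card V" using assms card_gt_0_iff[of V] by auto
  from rooted_subset_exists[OF assms this]
  obtain S d p where S: "S \<subseteq> V" "card S = card V" "rooted S r d p"
    using \<open>card V - 1 < card V\<close> by auto
  then have "S = V" using card_subset_eq finite_V by blast
  with S that show ?thesis by blast
qed

lemma rooted_V_D:
  assumes "rooted V r d p"
  shows "v \<in> V \<Longrightarrow> v \<noteq> r \<Longrightarrow> (v, p v) \<in> parcs T"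
    and "v \<in> V \<Longrightarrow> v \<noteq> r \<Longrightarrow> d v = Suc (d (p v))"
    and "(x, y) \<in> parcs T \<Longrightarrow> y \<noteq> r \<and> x = p y \<or> x \<noteq> r \<and> y = p x"
  using assms arc_in_V[of x y] unfolding rooted_def by auto

text \<open>Rooted at \<open>w\<close>, both \<open>a\<close> and \<open>b\<close> have parent
  \<open>w\<close>. A different common neighbour would be a child of both, but parents are
  unique.\<close>

lemma no_C4:
  assumes "(w, a) \<in> parcs T" "(w, b) \<in> parcs T" "(w', a) \<in> parcs T" "(w', b) \<in> parcs T" "a \<noteq> b"
  shows "w = w'"
proof -
  have "w \<in> V" using assms arc_in_V by blast
  then obtain d p where "rooted V w d p" by (rule rooting)
  note pa = rooted_V_D(1)[OF this] and d = rooted_V_D(2)[OF this] and p = rooted_V_D(3)[OF this]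
  have "p a = w" "p b = w" "a \<noteq> w" "b \<noteq> w" using p[OF assms(1)] p[OF assms(2)] by auto
  then show ?thesis using p[OF assms(3)] p[OF assms(4)] assms(5) by auto
qed

text \<open>Rooted at \<open>u\<close>, the parents of \<open>x\<close> and \<open>x'\<close> are
  \<open>v\<close> and \<open>v'\<close>. A common neighbour would force \<open>v = v'\<close> or
  put \<open>x\<close> or \<open>x'\<close> at the root. Degenerate cases such as
  \<open>x = x'\<close> or \<open>w = v\<close> are included.\<close>

lemma no_C6:
  assumes "(u, v) \<in> parcs T" "(u, v') \<in> parcs T" "v \<noteq> v'" "(v, x) \<in> parcs T" "(v', x') \<in> parcs T"
    "x \<noteq> u" "x' \<noteq> u" "(w, x) \<in> parcs T" "(w, x') \<in> parcs T"
  shows False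
proof -
  have "u \<in> V" using assms arc_in_V by blast
  then obtain d p where "rooted V u d p" by (rule rooting)
  note pa = rooted_V_D(1)[OF this] and d = rooted_V_D(2)[OF this] and p = rooted_V_D(3)[OF this]
  have v: "p v = u" "p v' = u" using p[OF assms(1)] p[OF assms(2)] by auto
  have x: "p x = v" "p x' = v'" using p[OF assms(4)] p[OF assms(5)] v assms(6,7) by auto
  show False using p[OF assms(8)] p[OF assms(9)] x v assms(3,6,7) by metis
qed

text \<open>The sides are given by the parity of the depth, which changes by one along every
  arc.\<close>

lemma bipartition:
  obtains X where "\<And>x y. (x, y) \<in> parcs T \<Longrightarrow> x \<in> X \<longleftrightarrow> y \<notin> X"
proof -
  obtain r where "r \<in> V" using V_nonempty by auto
  then obtain d p where "rooted V r d p" by (rule rooting)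
  note pa = rooted_V_D(1)[OF this] and d = rooted_V_D(2)[OF this] and p = rooted_V_D(3)[OF this]
  have "x \<in> {v. even (d v)} \<longleftrightarrow> y \<notin> {v. even (d v)}" if "(x, y) \<in> parcs T" for x y
    using p[OF that]
  proof
    assume y: "y \<noteq> r \<and> x = p y"
    then have "d y = Suc (d x)" using d[of y] arc_in_V[OF that] by metis
    then show ?thesis by simp
  next
    assume x: "x \<noteq> r \<and> y = p x"
    then have "d x = Suc (d y)" using d[of x] arc_in_V[OF that] by metis
    then show ?thesis by simp
  qed
  then show ?thesis using that by blast
qed

text \<open>For a vertex of maximal depth in \<open>B\<close>, a neighbour in \<open>B\<close> can
  only be the parent, so there is at most one.\<close>

lemma no_min_degree_two:
  assumes "B \<subseteq> V" "B \<noteq> {}"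
    and "\<And>x. x \<in> B \<Longrightarrow> \<exists>y\<in>B. \<exists>z\<in>B. y \<noteq> z \<and> (x, y) \<in> parcs T \<and> (x, z) \<in> parcs T"
  shows False
proof -
  obtain r where "r \<in> V" using V_nonempty by auto
  then obtain d p where "rooted V r d p" by (rule rooting)
  note pa = rooted_V_D(1)[OF this] and d = rooted_V_D(2)[OF this] and p = rooted_V_D(3)[OF this]
  have "finite B" using assms(1) finite_V finite_subset by blast
  then obtain x where x: "x \<in> B" "\<And>y. y \<in> B \<Longrightarrow> d y \<le> d x"
    using assms(2) obtains_MAX[of B d] Max_ge[of "d ` B"] by (metis finite_imageI imageI)
  obtain y z where yz: "y \<in> B" "z \<in> B" "y \<noteq> z" "(x, y) \<in> parcs T" "(x, z) \<in> parcs T"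
    using assms(3) x(1) by blast
  have "w = p x" if "w \<in> B" "(x, w) \<in> parcs T" for w
    using p[OF that(2)] d[of w] x(2)[OF that(1)] that assms(1) by fastforce
  then show False using yz by metis
qed

text \<open>Sending each vertex other than the root to the edge to its parent is a bijection onto
  the edges; two vertices cannot be parents of each other because of their depths.\<close>

lemma card_edges: "card {{x, y} |x y. (x, y) \<in> parcs T} = card V - 1"
proof -
  obtain r where r: "r \<in> V" using V_nonempty by auto
  then obtain d p where "rooted V r d p" by (rule rooting)
  note pa = rooted_V_D(1)[OF this] and d = rooted_V_D(2)[OF this] and p = rooted_V_D(3)[OF this]
  have "{{x, y} |x y. (x, y) \<in> parcs T} = (\<lambda>v. {v, p v}) ` (V - {r})"
  proof (intro subset_antisym subsetI)
    fix e assume "e \<in> {{x, y} |x y. (x, y) \<in> parcs T}"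
    then obtain x y where xy: "e = {x, y}" "(x, y) \<in> parcs T" by auto
    then show "e \<in> (\<lambda>v. {v, p v}) ` (V - {r})"
      using p[OF xy(2)] arc_in_V[OF xy(2)] by (auto simp: insert_commute)
  qed (use pa in auto)
  moreover have "inj_on (\<lambda>v. {v, p v}) (V - {r})"
  proof (rule inj_onI)
    fix v w assume vw: "v \<in> V - {r}" "w \<in> V - {r}" "{v, p v} = {w, p w}"
    then have "v = w \<or> v = p w \<and> w = p v" by (auto simp: doubleton_eq_iff)
    then show "v = w" using d[of v] d[of w] vw by auto
  qed
  ultimately show ?thesis using r by (simp add: card_image)
qed

subsection \<open>Total domination\<close>

abbreviation "\<gamma> \<equiv> total_domination_number T"

lemma has_neighbour:
  assumes "v \<in> V"
  obtains w where "(v, w) \<in> parcs T"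
proof -
  have "{v} \<noteq> V"
  proof
    assume "{v} = V"
    then have "card V = 1" by (metis is_singletonI is_singleton_altdef)
    then show False using card_V by simp
  qed
  then show ?thesis using crossing_arc[of "{v}"] assms that by blast
qed

lemma td_set_V: "td_set T V"
  unfolding td_set_def using has_neighbour arc_in_V by (metis IntI empty_iff mem_N subset_refl)

lemma card_td_set_ge: "td_set T D \<Longrightarrow> \<gamma> \<le> card D"
  unfolding total_domination_number_def by (rule Least_le) auto

lemma minimum_td_setI: "td_set T D \<Longrightarrow> card D \<le> \<gamma> \<Longrightarrow> minimum_td_set T D"
  using card_td_set_ge[of D] by (simp add: minimum_td_set_def)

lemma minimum_td_set_exists: "\<exists>D. minimum_td_set T D"
  unfolding minimum_td_set_def total_domination_number_def
  by (rule LeastI_ex) (use td_set_V in blast)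

text \<open>By minimality some vertex has no neighbour in \<open>D - {u}\<close>; being dominated by
  \<open>D\<close>, it sees \<open>u\<close> alone.\<close>

lemma private_nbhd_nonempty:
  assumes "minimum_td_set T D" "u \<in> D"
  shows "private_nbhd T u D \<noteq> {}"
proof -
  have D: "td_set T D" "card D = \<gamma>" using assms by (auto simp: minimum_td_set_def)
  then have "finite D" using finite_subset[OF _ finite_V] by (auto simp: td_set_def)
  then have "card (D - {u}) < \<gamma>" using D assms(2) by (metis card_Diff1_less)
  then have "\<not> td_set T (D - {u})" using card_td_set_ge by force
  then obtain v where v: "v \<in> V" "N v \<inter> (D - {u}) = {}"
    using D by (auto simp: td_set_def)
  then have "N v \<inter> D = {u}" using D by (auto simp: td_set_def)
  then show ?thesis using v by (auto simp: private_nbhd_def)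
qed

text \<open>The last three conjuncts are the conditions (a), (b) and (c).\<close>

definition good_partition :: "'a set \<Rightarrow> 'a set \<Rightarrow> 'a set \<Rightarrow> bool" where
  "good_partition D D1 D2 \<longleftrightarrow> minimum_td_set T D \<and> D = D1 \<union> D2 \<and> D1 \<inter> D2 = {} \<and>
     D2 \<subseteq> {u \<in> D. card (private_nbhd T u D) = 1} \<and>
     \<not> (\<exists>v \<in> V. card (N v \<inter> D) \<ge> 2 \<and> N v \<inter> D \<subseteq> D2) \<and>
     independent_set T (V - (D1 \<union> (\<Union>s \<in> (\<Union>v \<in> D2. private_nbhd T v D). closed_nbhd T s)))"

text \<open>
  \<open>K u\<close> plays the part of the color class represented by \<open>u\<close>, and the independent rest that of a
  color class which no vertex relies on.
\<close>

lemma good_partition_if_classes: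
  assumes D: "minimum_td_set T D"
    and K: "\<And>u. u \<in> D \<Longrightarrow> u \<in> K u"
    and dom: "\<And>v. v \<in> V \<Longrightarrow> \<exists>u\<in>D. K u \<subseteq> N v"
    and ind: "independent_set T (V - (\<Union>u\<in>D. K u))"
  shows "\<exists>D1 D2. good_partition D D1 D2"
proof -
  define D1 where "D1 = {u \<in> D. K u = {u}}"
  \<comment> \<open>The class in \<open>N w\<close> has its representative in
    \<open>N w \<inter> D = {u}\<close>, so it is \<open>K u\<close>.\<close>
  have sub: "K u \<subseteq> N w" if "u \<in> D" "w \<in> private_nbhd T u D" for u w
  proof -
    have w: "w \<in> V" "N w \<inter> D = {u}" using that by (auto simp: private_nbhd_def)
    then obtain u' where u': "u' \<in> D" "K u' \<subseteq> N w" using dom by blast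
    then have "u' \<in> N w \<inter> D" using K by blast
    then show ?thesis using w u' by auto
  qed
  \<comment> \<open>Outside \<open>D1\<close> the class has a second element, and two vertices have
    at most one common neighbour.\<close>
  have uniq: "w = w'" if u: "u \<in> D - D1" "K u \<subseteq> N w" "K u \<subseteq> N w'" for u w w'
  proof -
    obtain a where "a \<in> K u" "a \<noteq> u" using u(1) K unfolding D1_def by blast
    then show ?thesis using u K[of u] no_C4[of w u a w'] by (metis DiffD1 mem_N subsetD)
  qed
  have pn: "\<exists>w. private_nbhd T u D = {w} \<and> K u \<subseteq> N w" if u: "u \<in> D - D1" for u
  proof -
    obtain w where w: "w \<in> private_nbhd T u D" using private_nbhd_nonempty[OF D] u by blast
    then show ?thesis using u uniq[OF u] sub[of u] by blast
  qed
  \<comment> \<open>Condition (b): such a \<open>v\<close> sees all of \<open>K u\<close> for some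
    \<open>u\<close> outside \<open>D1\<close>, so it is the private neighbour of
    \<open>u\<close>.\<close>
  have "card (N v \<inter> D) < 2" if v: "v \<in> V" "N v \<inter> D \<subseteq> D - D1" for v
  proof -
    obtain u where u: "u \<in> D" "K u \<subseteq> N v" using dom v(1) by blast
    then have "u \<in> D - D1" using K v(2) by blast
    then obtain w where "private_nbhd T u D = {w}" "K u \<subseteq> N w" using pn by blast
    then have "private_nbhd T u D = {v}" using uniq[OF \<open>u \<in> D - D1\<close> u(2)] by simp
    then have "N v \<inter> D = {u}" by (auto simp: private_nbhd_def)
    then show ?thesis by simp
  qed
  then have b: "\<not> (\<exists>v \<in> V. card (N v \<inter> D) \<ge> 2 \<and> N v \<inter> D \<subseteq> D - D1)" by fastforce
  \<comment> \<open>The vertices left over in (c) lie outside all classes and hence are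
    independent.\<close>
  have "(\<Union>u\<in>D. K u) \<subseteq> D1 \<union> (\<Union>s \<in> (\<Union>v \<in> D - D1. private_nbhd T v D). closed_nbhd T s)"
  proof
    fix x assume "x \<in> (\<Union>u\<in>D. K u)"
    then obtain u where u: "u \<in> D" "x \<in> K u" by auto
    show "x \<in> D1 \<union> (\<Union>s \<in> (\<Union>v \<in> D - D1. private_nbhd T v D). closed_nbhd T s)"
    proof (cases "u \<in> D1")
      case True
      then show ?thesis using u by (auto simp: D1_def)
    next
      case False
      then obtain w where "private_nbhd T u D = {w}" "K u \<subseteq> N w" using pn u by blast
      then have "w \<in> (\<Union>v \<in> D - D1. private_nbhd T v D)" "x \<in> closed_nbhd T w"
        using u False by (auto simp: closed_nbhd_def)
      then show ?thesis by blast
    qed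
  qed
  then have c: "independent_set T
      (V - (D1 \<union> (\<Union>s \<in> (\<Union>v \<in> D - D1. private_nbhd T v D). closed_nbhd T s)))"
    using ind unfolding independent_set_def by blast
  have a: "D - D1 \<subseteq> {u \<in> D. card (private_nbhd T u D) = 1}" using pn by fastforce
  have "good_partition D D1 (D - D1)"
    unfolding good_partition_def using D a b c by (auto simp: D1_def)
  then show ?thesis by blast
qed

subsection \<open>Total dominator colorings\<close>

lemma td_coloringE:
  assumes "td_coloring T c" "v \<in> V"
  obtains y where "y \<in> V" "color_class T c (c y) \<subseteq> N v"
  using assms by (auto simp: td_coloring_def)

lemma self_in_class: "y \<in> V \<Longrightarrow> y \<in> color_class T c (c y)"
  by (simp add: color_class_def)

lemma td_coloring_exists: "\<exists>c. td_coloring T c"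
proof -
  obtain c :: "'a \<Rightarrow> nat" where c: "inj_on c V" using finite_imp_inj_to_nat_seg finite_V by metis
  have "proper_coloring T c"
    using c arc_in_V arc_irrefl unfolding proper_coloring_def inj_on_def by blast
  moreover have "\<exists>i \<in> c ` V. color_class T c i \<subseteq> N v" if "v \<in> V" for v
  proof -
    obtain w where w: "(v, w) \<in> parcs T" using has_neighbour \<open>v \<in> V\<close> by blast
    then have "color_class T c (c w) = {w}"
      using c arc_in_V[OF w] by (auto simp: color_class_def inj_on_def)
    then show ?thesis using w arc_in_V[OF w] by (intro bexI[of _ "c w"]) auto
  qed
  ultimately show ?thesis by (auto simp: td_coloring_def)
qed

lemma optimal_td_coloring:
  obtains c where "td_coloring T c" "card (c ` V) = td_chromatic_number T"
proof -
  have "\<exists>c. td_coloring T c \<and> card (c ` V) = td_chromatic_number T"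
    unfolding td_chromatic_number_def by (rule LeastI_ex) (use td_coloring_exists in blast)
  then show ?thesis using that by blast
qed

lemma td_chromatic_number_le: "td_coloring T c \<Longrightarrow> td_chromatic_number T \<le> card (c ` V)"
  unfolding td_chromatic_number_def by (rule Least_le) auto

text \<open>For every color missing on \<open>P\<close>, one vertex of that color is added.\<close>

lemma extend_transversal:
  assumes "P \<subseteq> V" "inj_on c P"
  obtains D where "P \<subseteq> D" "D \<subseteq> V" "inj_on c D" "c ` D = c ` V"
proof -
  define R where "R = inv_into V c ` (c ` V - c ` P)"
  have R: "R \<subseteq> V" by (auto simp: R_def inv_into_into)
  have cR: "c ` R = c ` V - c ` P"
    by (auto simp: R_def image_image f_inv_into_f intro!: rev_image_eqI)
  have "inj_on c R" by (rule inj_on_inverseI[of _ "inv_into V c"]) (auto simp: R_def f_inv_into_f)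
  then have "inj_on c (P \<union> R)" using assms cR by (auto simp: inj_on_Un)
  moreover have "c ` (P \<union> R) = c ` V" using cR assms(1) by auto
  ultimately show ?thesis using that[of "P \<union> R"] R assms(1) by auto
qed

text \<open>The class inside \<open>N v\<close> has a representative in \<open>D\<close>, which is
  then a neighbour of \<open>v\<close>.\<close>

lemma transversal_td_set:
  assumes "td_coloring T c" "D \<subseteq> V" "c ` D = c ` V"
  shows "td_set T D"
  unfolding td_set_def
proof (intro conjI ballI)
  fix v assume "v \<in> V"
  then obtain i where i: "i \<in> c ` V" "color_class T c i \<subseteq> N v"
    using assms(1) unfolding td_coloring_def by blast
  then obtain y where "y \<in> D" "c y = i" using assms(3) by (metis imageE)
  then have "y \<in> N v" using i assms(2) by (auto simp: color_class_def)
  then show "N v \<inter> D \<noteq> {}" using \<open>y \<in> D\<close> by blast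
qed (rule assms)

lemma total_domination_le_td_chromatic: "\<gamma> \<le> td_chromatic_number T"
proof -
  obtain c where c: "td_coloring T c" "card (c ` V) = td_chromatic_number T"
    by (rule optimal_td_coloring)
  obtain D where "D \<subseteq> V" "inj_on c D" "c ` D = c ` V"
    using extend_transversal[of "{}" c] by auto
  then show ?thesis using card_td_set_ge transversal_td_set c card_image by metis
qed

lemma coloring_if_good_partition:
  assumes "good_partition D D1 D2"
  shows "td_chromatic_number T \<le> \<gamma> + 1"
proof -
  have min: "minimum_td_set T D" and D: "D = D1 \<union> D2" "D1 \<inter> D2 = {}"
    and a: "\<And>u. u \<in> D2 \<Longrightarrow> card (private_nbhd T u D) = 1"
    and b: "\<And>v. v \<in> V \<Longrightarrow> N v \<inter> D \<subseteq> D2 \<Longrightarrow> card (N v \<inter> D) < 2"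
    and ind: "independent_set T
      (V - (D1 \<union> (\<Union>s \<in> (\<Union>v \<in> D2. private_nbhd T v D). closed_nbhd T s)))"
    using assms unfolding good_partition_def by fastforce+
  have DV: "D \<subseteq> V" and td: "\<And>v. v \<in> V \<Longrightarrow> N v \<inter> D \<noteq> {}" and cD: "card D = \<gamma>"
    using min by (auto simp: minimum_td_set_def td_set_def)
  have fD: "finite D" using DV finite_V finite_subset by blast
  have "\<forall>u\<in>D2. \<exists>x. private_nbhd T u D = {x}" using a by (meson card_1_singletonE)
  then obtain w where w: "\<And>u. u \<in> D2 \<Longrightarrow> private_nbhd T u D = {w u}" by metis
  have wN: "w u \<in> V" "N (w u) \<inter> D = {u}" if "u \<in> D2" for u
    using w[OF that] by (auto simp: private_nbhd_def)
  obtain e :: "'a \<Rightarrow> nat" where e: "inj_on e V" using finite_imp_inj_to_nat_seg finite_V by metis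
  define R where "R = (\<Union>u\<in>D2. N (w u)) - D1"
  \<comment> \<open>A vertex may be adjacent to several \<open>w u\<close>; \<open>q x\<close> fixes
    the one whose class \<open>x\<close> joins.\<close>
  define q where "q x = (SOME u. u \<in> D2 \<and> x \<in> N (w u))" for x
  \<comment> \<open>\<open>Suc\<close> keeps the color 0 free for the vertices outside
    \<open>D1\<close> and \<open>R\<close>.\<close>
  define c where "c x = (if x \<in> D1 then Suc (e x) else if x \<in> R then Suc (e (q x)) else 0)" for x
  have q: "q x \<in> D2" "x \<in> N (w (q x))" if "x \<in> R" for x
  proof -
    have "\<exists>u. u \<in> D2 \<and> x \<in> N (w u)" using that by (auto simp: R_def)
    from someI_ex[OF this] show "q x \<in> D2" "x \<in> N (w (q x))" by (simp_all add: q_def)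
  qed
  \<comment> \<open>\<open>w (q u)\<close> has \<open>q u\<close> as its only neighbour in
    \<open>D\<close>, so \<open>u\<close> gets its own color.\<close>
  have D2R: "u \<in> R" "q u = u" if "u \<in> D2" for u
  proof -
    have "u \<in> N (w u)" using wN(2)[OF that] by blast
    then show "u \<in> R" using that D unfolding R_def by blast
    then have "u \<in> N (w (q u)) \<inter> D" using q that D by blast
    then show "q u = u" using wN(2)[of "q u"] q(1)[OF \<open>u \<in> R\<close>] by auto
  qed
  have e_eq: "x = y" if "e x = e y" "x \<in> D" "y \<in> D" for x y
    using that e DV by (auto simp: inj_on_def)
  have DR: "D1 \<inter> R = {}" by (auto simp: R_def)
  have class1: "color_class T c (c x) = {x}" if "x \<in> D1" for x
    using that q DV D DR by (auto simp: color_class_def c_def split: if_splits dest!: e_eq)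
  have class2: "color_class T c (c u) \<subseteq> N (w u)" if "u \<in> D2" for u
  proof
    fix y assume "y \<in> color_class T c (c u)"
    moreover have "c u = Suc (e u)" using that D2R[OF that] D by (auto simp: c_def)
    ultimately have "y \<in> V" "c y = Suc (e u)" by (auto simp: color_class_def)
    moreover have "y \<notin> D1" using calculation e_eq[of y u] that D by (auto simp: c_def)
    ultimately have "y \<in> R" "e (q y) = e u" by (auto simp: c_def split: if_splits)
    then have "q y = u" using q(1)[of y] that D by (intro e_eq) auto
    then show "y \<in> N (w u)" using q(2)[OF \<open>y \<in> R\<close>] by simp
  qed
  have "proper_coloring T c"
    unfolding proper_coloring_def
  proof clarify
    fix x y assume xy: "(x, y) \<in> parcs T" "c x = c y"
    have V: "x \<in> V" "y \<in> V" using arc_in_V[OF xy(1)] by auto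
    show False
    proof (cases "x \<in> D1 \<or> y \<in> D1")
      case True
      then have "x = y" using class1 self_in_class V xy(2) by (metis singletonD)
      then show False using xy by simp
    next
      case nD1: False
      show False
      proof (cases "x \<in> R")
        case True
        then have "y \<in> R" using xy(2) nD1 by (auto simp: c_def split: if_splits)
        then have "e (q x) = e (q y)" using True xy(2) nD1 by (simp add: c_def)
        then have "q x = q y" using q(1) True \<open>y \<in> R\<close> D by (intro e_eq) auto
        \<comment> \<open>Adjacent \<open>x\<close> and \<open>y\<close> would form a triangle with
          \<open>w (q x)\<close>.\<close>
        then have "(w (q x), x) \<in> parcs T" "(w (q x), y) \<in> parcs T"
          using q(2)[OF True] q(2)[OF \<open>y \<in> R\<close>] by auto
        then show False using bipartition xy(1) by metis
      next
        case False
        then have "y \<notin> R" using xy(2) nD1 by (auto simp: c_def split: if_splits)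
        \<comment> \<open>Two vertices of color 0: such a vertex escapes the independent set of (c)
          only by being some \<open>w u\<close>. But all neighbours of \<open>w u\<close> lie in
          \<open>D1\<close> or \<open>R\<close>, whereas \<open>x\<close> and \<open>y\<close> are
          adjacent and both outside.\<close>
        have out: "z \<in> V - (D1 \<union> (\<Union>s \<in> (\<Union>v \<in> D2. private_nbhd T v D). closed_nbhd T s))"
          if "z \<in> {x, y}" "z \<notin> w ` D2" for z
          using that w nD1 False \<open>y \<notin> R\<close> V by (auto simp: R_def closed_nbhd_def)
        have "x \<notin> w ` D2" "y \<notin> w ` D2"
          using nD1 False \<open>y \<notin> R\<close> xy(1) arc_sym[OF xy(1)] by (auto simp: R_def)
        then show False using out[of x] out[of y] ind xy(1) unfolding independent_set_def by blast
      qed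
    qed
  qed
  \<comment> \<open>If all neighbours of \<open>v\<close> in \<open>D\<close> lie in
    \<open>D2\<close>, then (b) leaves a single one, \<open>u\<close>, so \<open>v = w u\<close>
    sees the class of \<open>u\<close>. Otherwise \<open>v\<close> sees a vertex of
    \<open>D1\<close>, which is a class by itself.\<close>
  moreover have "\<exists>i \<in> c ` V. color_class T c i \<subseteq> N v" if v: "v \<in> V" for v
  proof (cases "N v \<inter> D \<subseteq> D2")
    case True
    then have "card (N v \<inter> D) < 2" using b v by blast
    moreover obtain u where u: "u \<in> N v \<inter> D" using td[OF v] by blast
    ultimately have "\<forall>a\<in>N v \<inter> D. \<forall>b\<in>N v \<inter> D. a = b"
      using fD card_le_Suc0_iff_eq[of "N v \<inter> D"] by simp
    then have "N v \<inter> D = {u}" using u by blast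
    then have "v \<in> private_nbhd T u D" using v by (simp add: private_nbhd_def)
    then have "v = w u" "u \<in> D2" using w True u by auto
    then show ?thesis using class2[of u] u DV by blast
  next
    case False
    then obtain u where "u \<in> N v" "u \<in> D1" using D by blast
    then have "c u \<in> c ` V" "color_class T c (c u) \<subseteq> N v" using class1[of u] DV D by auto
    then show ?thesis by blast
  qed
  ultimately have "td_coloring T c" by (simp add: td_coloring_def)
  then have "td_chromatic_number T \<le> card (c ` V)" by (rule td_chromatic_number_le)
  also have "c ` V \<subseteq> insert 0 ((Suc \<circ> e) ` D)"
    using q D by (auto simp: c_def)
  then have "card (c ` V) \<le> card (insert 0 ((Suc \<circ> e) ` D))" using fD by (intro card_mono) auto
  also have "\<dots> \<le> Suc (card D)"
    using fD card_image_le[of D "Suc \<circ> e"] card_insert_le_m1 by (simp add: card_insert_if)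
  finally show ?thesis using cD by simp
qed

text \<open>Representatives of the classes other than \<open>i0\<close> are at most \<gamma> in
  number and still dominate. A vertex in none of their classes has color \<open>i0\<close>, so these
  vertices are independent.\<close>

lemma good_partition_if_unneeded_class:
  assumes c: "td_coloring T c" "card (c ` V) = \<gamma> + 1" and i0: "i0 \<in> c ` V"
    and free: "\<And>v. v \<in> V \<Longrightarrow> \<exists>i \<in> c ` V - {i0}. color_class T c i \<subseteq> N v"
  shows "\<exists>D D1 D2. good_partition D D1 D2"
proof -
  define D where "D = inv_into V c ` (c ` V - {i0})"
  have D: "D \<subseteq> V" by (auto simp: D_def inv_into_into)
  have dom: "\<exists>u\<in>D. color_class T c (c u) \<subseteq> N v" if "v \<in> V" for v
    using free[OF that] by (auto simp: D_def f_inv_into_f)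
  have "td_set T D"
    unfolding td_set_def using D dom self_in_class by blast
  moreover have "card D \<le> \<gamma>"
  proof -
    have "card D \<le> card (c ` V - {i0})" unfolding D_def by (rule card_image_le) simp
    then show ?thesis using c(2) i0 by simp
  qed
  ultimately have "minimum_td_set T D" by (rule minimum_td_setI)
  moreover have "independent_set T (V - (\<Union>u\<in>D. color_class T c (c u)))"
  proof -
    have "x \<in> (\<Union>u\<in>D. color_class T c (c u))" if "x \<in> V" "c x \<noteq> i0" for x
      using that by (auto simp: D_def color_class_def f_inv_into_f)
    then have "c x = i0" if "x \<in> V - (\<Union>u\<in>D. color_class T c (c u))" for x
      using that by blast
    moreover have "c x \<noteq> c y" if "(x, y) \<in> parcs T" for x y
      using c(1) that by (auto simp: td_coloring_def proper_coloring_def)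
    ultimately show ?thesis unfolding independent_set_def by (metis Diff_subset)
  qed
  ultimately show ?thesis
    using good_partition_if_classes[of D "\<lambda>u. color_class T c (c u)"] D dom self_in_class by blast
qed

text \<open>Classes are mixed: singletons of \<open>D0\<close> inside \<open>X\<close>, classes of
  \<open>c\<close> restricted to representatives outside \<open>X\<close>. A vertex of
  \<open>X\<close> has its neighbours outside \<open>X\<close> and keeps the class it dominates
  under \<open>c\<close>; a vertex outside \<open>X\<close> sees a vertex of \<open>D0\<close> in
  \<open>X\<close>. Uncovered vertices all lie in \<open>X\<close>, hence are independent.\<close>

lemma good_partition_if_one_side_tight:
  assumes c: "td_coloring T c" and X: "\<And>x y. (x, y) \<in> parcs T \<Longrightarrow> x \<in> X \<longleftrightarrow> y \<notin> X"
    and D0: "minimum_td_set T D0" and card: "card (c ` (V - X)) \<le> card (D0 - X)"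
  shows "\<exists>D D1 D2. good_partition D D1 D2"
proof -
  define R where "R = inv_into (V - X) c ` (c ` (V - X))"
  define D where "D = (D0 \<inter> X) \<union> R"
  define K where "K u = (if u \<in> X then {u} else color_class T c (c u))" for u
  have R: "R \<subseteq> V - X" unfolding R_def by (intro image_subsetI inv_into_into)
  have rep: "\<exists>u\<in>R. c u = c y" if "y \<in> V - X" for y
    using that by (auto simp: R_def f_inv_into_f[of _ c "V - X"] intro!: bexI)
  have D0': "td_set T D0" "card D0 = \<gamma>" using D0 by (auto simp: minimum_td_set_def)
  then have D0V: "D0 \<subseteq> V" by (simp add: td_set_def)
  then have fin: "finite D0" using finite_V finite_subset by blast
  have D: "D \<subseteq> V" using D0V R by (auto simp: D_def)
  have dom: "\<exists>u\<in>D. K u \<subseteq> N v" if v: "v \<in> V" for v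
  proof (cases "v \<in> X")
    case True
    obtain y where y: "y \<in> V" "color_class T c (c y) \<subseteq> N v" using td_coloringE[OF c v] .
    then have "(v, y) \<in> parcs T" using self_in_class by fastforce
    then have "y \<in> V - X" using X True y by blast
    then obtain u where "u \<in> R" "c u = c y" using rep by blast
    then have "u \<in> D" "K u \<subseteq> N v" using y R by (auto simp: D_def K_def)
    then show ?thesis by blast
  next
    case False
    obtain u where "u \<in> D0" "u \<in> N v" using D0' v unfolding td_set_def by blast
    moreover from this have "u \<in> X" using X False by simp
    ultimately have "u \<in> D" "K u \<subseteq> N v" by (auto simp: D_def K_def)
    then show ?thesis by blast
  qed
  have K: "u \<in> K u" if "u \<in> D" for u using that D by (auto simp: K_def self_in_class)
  have "td_set T D" unfolding td_set_def using D dom K by blast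
  moreover have "card D \<le> \<gamma>"
  proof -
    have "card R \<le> card (D0 - X)"
      unfolding R_def by (rule order_trans[OF card_image_le card]) simp
    then have "card D \<le> card (D0 \<inter> X) + card (D0 - X)"
      unfolding D_def by (rule order_trans[OF card_Un_le add_left_mono])
    also have "\<dots> = card D0" using fin by (metis Int_Diff_Un Int_Diff_disjoint card_Un_disjoint
          finite_Diff finite_Int)
    finally show ?thesis using D0' by simp
  qed
  ultimately have "minimum_td_set T D" by (rule minimum_td_setI)
  moreover have "independent_set T (V - (\<Union>u\<in>D. K u))"
  proof -
    have "x \<in> X" if x: "x \<in> V - (\<Union>u\<in>D. K u)" for x
    proof (rule ccontr)
      assume "x \<notin> X"
      then obtain u where "u \<in> R" "c u = c x" using rep x by blast
      then have "u \<in> D" "x \<in> K u" using R x by (auto simp: D_def K_def color_class_def)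
      then show False using x by blast
    qed
    then show ?thesis unfolding independent_set_def using X by (metis Diff_subset)
  qed
  ultimately show ?thesis using good_partition_if_classes[of D K] K dom by blast
qed

text \<open>
  If every class of a coloring with \<open>\<gamma> + 1\<close> colors is needed, every class lies in a neighbourhood
  and hence on one side of the bipartition. One of the two sides then uses no more colors than
  a minimum TD-set has vertices there, and the other side can be recolored.
\<close>

lemma good_partition_if_coloring:
  assumes "td_chromatic_number T = \<gamma> + 1"
  shows "\<exists>D D1 D2. good_partition D D1 D2"
proof -
  obtain c where c: "td_coloring T c" "card (c ` V) = \<gamma> + 1"
    using optimal_td_coloring assms by metis
  obtain X where X: "\<And>x y. (x, y) \<in> parcs T \<Longrightarrow> x \<in> X \<longleftrightarrow> y \<notin> X" using bipartition by blast
  obtain D0 where D0: "minimum_td_set T D0" using minimum_td_set_exists by blast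
  show ?thesis
  proof (cases "\<exists>i0\<in>c ` V. \<forall>v\<in>V. \<exists>i \<in> c ` V - {i0}. color_class T c i \<subseteq> N v")
    case True
    then show ?thesis using good_partition_if_unneeded_class[OF c] by blast
  next
    case False
    have side: "\<exists>v. color_class T c i \<subseteq> N v" if "i \<in> c ` V" for i
    proof -
      obtain v where v: "v \<in> V" "\<not> (\<exists>j \<in> c ` V - {i}. color_class T c j \<subseteq> N v)"
        using False \<open>i \<in> c ` V\<close> by blast
      moreover obtain j where "j \<in> c ` V" "color_class T c j \<subseteq> N v"
        using c(1) v(1) unfolding td_coloring_def by blast
      ultimately show ?thesis by blast
    qed
    have "c x \<noteq> c y" if xy: "x \<in> V \<inter> X" "y \<in> V - X" for x y
    proof
      assume "c x = c y"
      moreover obtain v where "color_class T c (c x) \<subseteq> N v" using side xy by blast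
      ultimately have "(v, x) \<in> parcs T" "(v, y) \<in> parcs T"
        using xy by (auto simp: color_class_def)
      then show False using X xy by blast
    qed
    then have disj: "c ` (V \<inter> X) \<inter> c ` (V - X) = {}" by blast
    have "c ` V = c ` (V \<inter> X) \<union> c ` (V - X)" by blast
    then have "card (c ` V) = card (c ` (V \<inter> X)) + card (c ` (V - X))"
      using card_Un_disjoint[OF _ _ disj] by simp
    moreover have "\<gamma> = card (D0 \<inter> X) + card (D0 - X)"
    proof -
      have "finite D0" using D0 finite_subset[OF _ finite_V]
        by (auto simp: minimum_td_set_def td_set_def)
      then have "card D0 = card (D0 \<inter> X) + card (D0 - X)"
        by (metis Int_Diff_Un Int_Diff_disjoint card_Un_disjoint finite_Diff finite_Int)
      then show ?thesis using D0 by (simp add: minimum_td_set_def)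
    qed
    \<comment> \<open>If both inequalities failed, there would be at least \<gamma> + 2
      colors.\<close>
    ultimately have "card (c ` (V - X)) \<le> card (D0 - X) \<or> card (c ` (V \<inter> X)) \<le> card (D0 \<inter> X)"
      using c(2) by linarith
    then show ?thesis
    proof
      assume "card (c ` (V - X)) \<le> card (D0 - X)"
      then show ?thesis using good_partition_if_one_side_tight[OF c(1) X D0] by blast
    next
      assume "card (c ` (V \<inter> X)) \<le> card (D0 \<inter> X)"
      then show ?thesis
        using good_partition_if_one_side_tight[OF c(1) _ D0, of "- X"] X by (simp add: Diff_eq)
    qed
  qed
qed

subsection \<open>The star family\<close>

text \<open>No arc leaves \<open>{x, y}\<close>, so by connectedness there are no other
  vertices.\<close>

lemma P2_if_adjacent_leaves:
  assumes "N x = {y}" "N y = {x}"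
  shows "is_P2 T"
proof -
  have xy: "(x, y) \<in> parcs T" "(y, x) \<in> parcs T" using assms by (metis insertI1 mem_N)+
  have V: "V = {x, y}"
  proof (rule ccontr)
    assume "V \<noteq> {x, y}"
    then obtain a b where "a \<in> {x, y}" "b \<in> V - {x, y}" "(a, b) \<in> parcs T"
      using crossing_arc[of "{x, y}"] arc_in_V[OF xy(1)] by blast
    then show False using assms by (metis DiffE insertE insertI1 insertI2 mem_N singletonD)
  qed
  have "parcs T = {(x, y), (y, x)}"
  proof (intro subset_antisym subrelI)
    fix a b assume ab: "(a, b) \<in> parcs T"
    then have "a \<noteq> b" "a \<in> {x, y}" "b \<in> {x, y}" using arc_in_V[OF ab] V by auto
    then show "(a, b) \<in> {(x, y), (y, x)}" by auto
  qed (use xy in auto)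
  moreover have "x \<noteq> y" using xy by auto
  ultimately have "T = \<lparr>pverts = {x, y}, parcs = {(x, y), (y, x)}\<rparr>" using V by simp
  then show ?thesis unfolding is_P2_def using \<open>x \<noteq> y\<close> by blast
qed

text \<open>The vertices of \<open>Z\<close> serve as centers: their closed neighbourhoods partition
  \<open>V\<close> into stars, and the added edges are those avoiding \<open>Z\<close>. Of the
  \<open>card V - 1\<close> edges, \<open>card V - card Z\<close> are star edges, which leaves
  \<open>card Z - 1\<close> added ones.\<close>

lemma star_familyI:
  assumes Z: "Z \<subseteq> V" "\<And>z. z \<in> Z \<Longrightarrow> support_vertex T z" "\<And>z. z \<in> Z \<Longrightarrow> card (N z) \<ge> 2"
    and indep: "\<And>z z'. z \<in> Z \<Longrightarrow> z' \<in> Z \<Longrightarrow> (z, z') \<notin> parcs T"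
    and ex1: "\<And>v. v \<in> V - Z \<Longrightarrow> \<exists>!z. z \<in> Z \<and> (v, z) \<in> parcs T"
  shows "T \<in> star_family"
proof -
  define F where "F = {{a, b} |a b. (a, b) \<in> parcs T \<and> a \<notin> Z \<and> b \<notin> Z}"
  define E where "E = {{a, b} |a b. (a, b) \<in> parcs T}"
  define S where "S z = \<lparr>pverts = insert z (N z), parcs = {z} \<times> N z \<union> N z \<times> {z}\<rparr>" for z
  define k where "k = card Z"
  have finZ: "finite Z" using Z(1) finite_V finite_subset by blast
  have "Z \<noteq> {}" using V_nonempty ex1 by blast
  then have k: "k \<ge> 1" using finZ by (simp add: k_def Suc_leI card_gt_0_iff)
  obtain h where "bij_betw h {0..<k} Z" using ex_bij_betw_nat_finite finZ k_def by blast
  then have h: "inj_on h {..<k}" "h ` {..<k} = Z"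
    by (auto simp: bij_betw_def atLeast0LessThan)
  then have hZ: "h i \<in> Z" if "i < k" for i using that by blast
  have hE: "\<exists>i<k. h i = z" if "z \<in> Z" for z using h(2) that by (metis imageE lessThan_iff)
  have NZ: "v \<in> V - Z" if "z \<in> Z" "(z, v) \<in> parcs T" for z v
    using indep that arc_in_V[OF that(2)] by blast
  have star: "star_with_center (S z) z \<and> card (pverts (S z)) \<ge> 3" if "z \<in> Z" for z
  proof -
    have "finite (N z)" using finite_subset[OF _ finite_V, of "N z"] by (auto simp: nbhd_def)
    then show ?thesis using Z(3)[OF that] by (auto simp: star_with_center_def S_def)
  qed
  have leaf: "leaf (S z) v" if "z \<in> Z" "(z, v) \<in> parcs T" for z v
  proof -
    have "v \<noteq> z" using that(2) by auto
    then have "nbhd (S z) v = {z}" using that(2) arc_in_V[OF that(2)] by (auto simp: nbhd_def S_def)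
    then show ?thesis using that(2) by (simp add: leaf_def S_def)
  qed
  have leaf': "\<exists>i<k. leaf (S (h i)) v" if v: "v \<in> V - Z" for v
  proof -
    obtain z where "z \<in> Z" "(v, z) \<in> parcs T" using ex1[OF v] by blast
    then show ?thesis using leaf arc_sym hE by metis
  qed
  have disj: "pverts (S (h i)) \<inter> pverts (S (h j)) = {}" if "i < k" "j < k" "i \<noteq> j" for i j
  proof (rule ccontr)
    have ne: "h i \<noteq> h j" using h(1) that by (auto simp: inj_on_def)
    assume "\<not> ?thesis"
    then obtain v where v: "v \<in> insert (h i) (N (h i))" "v \<in> insert (h j) (N (h j))"
      unfolding S_def pair_pre_digraph.simps by blast
    show False
    proof (cases "v \<in> Z")
      case True
      then have "v = h i" "v = h j" using v indep hZ that by (metis insertE mem_N)+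
      then show False using ne by simp
    next
      case False
      then have a: "(h i, v) \<in> parcs T" "(h j, v) \<in> parcs T" using v hZ that by (metis insertE mem_N)+
      then have "v \<in> V - Z" using False arc_in_V by blast
      then show False using ex1[of v] arc_sym[OF a(1)] arc_sym[OF a(2)] hZ that ne by blast
    qed
  qed
  have F_ends: "\<exists>a b. a \<noteq> b \<and> e = {a, b} \<and> (\<exists>i<k. leaf (S (h i)) a) \<and> (\<exists>j<k. leaf (S (h j)) b)"
    if e: "e \<in> F" for e
  proof -
    obtain a b where ab: "e = {a, b}" "(a, b) \<in> parcs T" "a \<notin> Z" "b \<notin> Z"
      using e by (auto simp: F_def)
    then have "a \<noteq> b" by auto
    then show ?thesis using leaf' ab arc_in_V[OF ab(2)] by (metis DiffI)
  qed
  have F_arcs: "{(a, b). {a, b} \<in> F} = {(a, b) \<in> parcs T. a \<notin> Z \<and> b \<notin> Z}"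
    by (auto simp: F_def doubleton_eq_iff intro: arc_sym)
  have verts: "V = (\<Union>i<k. pverts (S (h i)))"
  proof (intro subset_antisym subsetI)
    fix v assume v: "v \<in> V"
    show "v \<in> (\<Union>i<k. pverts (S (h i)))"
    proof (cases "v \<in> Z")
      case True
      then show ?thesis using hE by (fastforce simp: S_def)
    next
      case False
      then obtain z where z: "z \<in> Z" "(v, z) \<in> parcs T" using ex1 v by blast
      then obtain i where "i < k" "h i = z" using hE by blast
      then show ?thesis using arc_sym[OF z(2)] by (auto simp: S_def)
    qed
  next
    fix v assume "v \<in> (\<Union>i<k. pverts (S (h i)))"
    then obtain i where "i < k" "v = h i \<or> (h i, v) \<in> parcs T" by (auto simp: S_def)
    then show "v \<in> V" using hZ Z(1) arc_in_V by blast
  qed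
  have arcs: "parcs T = (\<Union>i<k. parcs (S (h i))) \<union> {(a, b). {a, b} \<in> F}"
    unfolding F_arcs
  proof (intro subset_antisym subrelI)
    fix a b assume ab: "(a, b) \<in> parcs T"
    have "(a, b) \<in> (\<Union>i<k. parcs (S (h i)))" if "a \<in> Z \<or> b \<in> Z"
      using that
    proof
      assume "a \<in> Z"
      then obtain i where "i < k" "h i = a" using hE by blast
      then show ?thesis using ab by (auto simp: S_def)
    next
      assume "b \<in> Z"
      then obtain i where "i < k" "h i = b" using hE by blast
      then show ?thesis using arc_sym[OF ab] by (auto simp: S_def)
    qed
    then show "(a, b) \<in> (\<Union>i<k. parcs (S (h i))) \<union> {(a, b) \<in> parcs T. a \<notin> Z \<and> b \<notin> Z}"
      using ab by blast
  next
    fix a b assume "(a, b) \<in> (\<Union>i<k. parcs (S (h i))) \<union> {(a, b) \<in> parcs T. a \<notin> Z \<and> b \<notin> Z}"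
    then show "(a, b) \<in> parcs T" by (auto simp: S_def intro: arc_sym)
  qed
  \<comment> \<open>\<open>s v\<close> is the center of the star containing \<open>v\<close>; star
    edges are counted by their leaves.\<close>
  obtain s where s: "\<And>v. v \<in> V - Z \<Longrightarrow> s v \<in> Z \<and> (v, s v) \<in> parcs T" using ex1 by metis
  have "E = F \<union> (\<lambda>v. {v, s v}) ` (V - Z)"
  proof (intro subset_antisym subsetI)
    fix e assume "e \<in> E"
    then obtain a b where ab: "e = {a, b}" "(a, b) \<in> parcs T" by (auto simp: E_def)
    have star_edge: "{z, v} \<in> (\<lambda>v. {v, s v}) ` (V - Z)" if "z \<in> Z" "(z, v) \<in> parcs T" for z v
    proof -
      have "v \<in> V - Z" using NZ that by blast
      moreover have "s v = z" using s ex1 calculation that arc_sym[OF that(2)] by blast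
      ultimately show ?thesis by (intro image_eqI[of _ _ v]) auto
    qed
    consider "a \<in> Z" | "b \<in> Z" | "a \<notin> Z" "b \<notin> Z" by blast
    then show "e \<in> F \<union> (\<lambda>v. {v, s v}) ` (V - Z)"
    proof cases
      case 1
      then show ?thesis using star_edge ab by blast
    next
      case 2
      then show ?thesis using star_edge[OF 2 arc_sym[OF ab(2)]] ab(1) by (simp add: insert_commute)
    next
      case 3
      then show ?thesis using ab by (auto simp: F_def)
    qed
  next
    fix e assume "e \<in> F \<union> (\<lambda>v. {v, s v}) ` (V - Z)"
    then show "e \<in> E" using s unfolding E_def F_def by blast
  qed
  moreover have "F \<inter> (\<lambda>v. {v, s v}) ` (V - Z) = {}"
    using s by (fastforce simp: F_def doubleton_eq_iff)
  moreover have "finite E"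
  proof -
    have "E \<subseteq> Pow V" using arc_in_V by (auto simp: E_def)
    then show ?thesis using finite_subset by fastforce
  qed
  ultimately have "card E = card F + card ((\<lambda>v. {v, s v}) ` (V - Z))"
    by (metis card_Un_disjoint finite_Un)
  moreover have "inj_on (\<lambda>v. {v, s v}) (V - Z)"
    using s by (fastforce simp: inj_on_def doubleton_eq_iff)
  then have "card ((\<lambda>v. {v, s v}) ` (V - Z)) = card V - k"
    using Z(1) finZ by (simp add: card_image card_Diff_subset k_def)
  moreover have "card E = card V - 1" unfolding E_def by (rule card_edges)
  moreover have "k \<le> card V" using Z(1) by (simp add: k_def card_mono)
  ultimately have cF: "card F = k - 1" using k by linarith
  have T: "T = \<lparr>pverts = (\<Union>i<k. pverts (S (h i))),
      parcs = (\<Union>i<k. parcs (S (h i))) \<union> {(a, b). {a, b} \<in> F}\<rparr>"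
    using verts arcs by simp
  have "\<exists>(k::nat) St z F. k \<ge> 1 \<and>
         (\<forall>i<k. star_with_center (St i) (z i) \<and> card (pverts (St i)) \<ge> 3) \<and>
         (\<forall>i<k. \<forall>j<k. i \<noteq> j \<longrightarrow> pverts (St i) \<inter> pverts (St j) = {}) \<and>
         (\<forall>e\<in>F. \<exists>a b. a \<noteq> b \<and> e = {a, b} \<and>
            (\<exists>i<k. leaf (St i) a) \<and> (\<exists>j<k. leaf (St j) b)) \<and>
         card F = k - 1 \<and>
         T = \<lparr>pverts = (\<Union>i<k. pverts (St i)),
              parcs = (\<Union>i<k. parcs (St i)) \<union> {(a, b). {a, b} \<in> F}\<rparr> \<and>
         (\<forall>i<k. support_vertex T (z i))"
    by (rule exI[of _ k], rule exI[of _ "\<lambda>i. S (h i)"], rule exI[of _ h], rule exI[of _ F],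
        intro conjI)
      (use k star hZ disj F_ends cF T Z(2) in \<open>blast+\<close>)
  then show ?thesis unfolding star_family_def using tree by blast
qed

end

section \<open>Trees with a TD-coloring in \<gamma> colors\<close>

locale tight_td_coloring = undirected_tree_graph T for T :: "'a pair_pre_digraph" +
  fixes c :: "'a \<Rightarrow> nat"
  assumes coloring: "td_coloring T c"
    and tight: "card (c ` pverts T) = total_domination_number T"
begin

abbreviation "C x \<equiv> color_class T c (c x)"

lemma class_eq: "y \<in> C x \<Longrightarrow> C y = C x"
  by (simp add: color_class_def)

text \<open>
  Every set of representatives of the color classes is a minimum TD-set, so none of its members
  can be dropped.
\<close>

lemma class_needed:
  assumes "P \<subseteq> V" "x \<in> V" "x \<notin> P" "inj_on c (insert x P)"
  obtains v where "v \<in> V" "C x \<subseteq> N v" "N v \<inter> P = {}"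
proof -
  obtain D where D: "insert x P \<subseteq> D" "D \<subseteq> V" "inj_on c D" "c ` D = c ` V"
    using extend_transversal[of "insert x P" c] assms by auto
  have "finite D" using D(2) finite_V finite_subset by blast
  moreover have "card D = \<gamma>" using D(3,4) tight card_image by metis
  ultimately have "card (D - {x}) < \<gamma>" using D(1) by (metis card_Diff1_less insert_subset)
  then have "\<not> td_set T (D - {x})" using card_td_set_ge by force
  then obtain v where v: "v \<in> V" "N v \<inter> (D - {x}) = {}" using D(2) by (auto simp: td_set_def)
  obtain y where y: "y \<in> V" "C y \<subseteq> N v" using td_coloringE[OF coloring v(1)] .
  then obtain z where z: "z \<in> D" "c z = c y" using D(4) by (metis imageE imageI)
  then have "z \<in> N v" using y D(2) by (auto simp: color_class_def)
  then have "z = x" using v(2) z(1) by blast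
  then show ?thesis using that[of v] v y z D(1) assms(3) by auto
qed

lemma class_in_nbhd:
  assumes "x \<in> V"
  obtains v where "v \<in> V" "C x \<subseteq> N v"
  using class_needed[of "{}" x] assms by auto

lemma leafE:
  assumes "leaf T l"
  obtains z where "N l = {z}" "z \<in> V"
proof -
  obtain z where z: "N l = {z}" using assms by (auto simp: leaf_def card_1_singleton_iff)
  then have "(l, z) \<in> parcs T" by (metis insertI1 mem_N)
  then show ?thesis using that z arc_in_V by blast
qed

text \<open>A leaf at \<open>z\<close> has no other neighbour, so the class that it dominates can
  only be \<open>{z}\<close>.\<close>

lemma support_singleton:
  assumes "support_vertex T z"
  shows "C z = {z}"
proof -
  obtain l where l: "(z, l) \<in> parcs T" "leaf T l"
    using assms by (auto simp: support_vertex_def)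
  then have "N l = {z}" using leafE arc_sym[OF l(1)] by (metis mem_N singletonD)
  moreover have "l \<in> V" using l by (simp add: leaf_def)
  ultimately obtain y where y: "y \<in> V" "C y \<subseteq> {z}" using td_coloringE[OF coloring] by metis
  then have "y = z" using self_in_class by fastforce
  then show ?thesis using y self_in_class by fastforce
qed

lemma singleton_support:
  assumes u: "u \<in> V" "C u = {u}"
  shows "support_vertex T u"
proof (rule ccontr)
  assume no: "\<not> support_vertex T u"
  have "\<exists>x. (v, x) \<in> parcs T \<and> x \<noteq> u" if v: "(u, v) \<in> parcs T" for v
  proof (rule ccontr)
    assume "\<not> ?thesis"
    then have "x \<in> N v \<longleftrightarrow> x = u" for x using arc_sym[OF v] by (metis mem_N)
    then have "N v = {u}" by blast
    then have "leaf T v" using arc_in_V[OF v] by (simp add: leaf_def)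
    then show False using no v u by (auto simp: support_vertex_def)
  qed
  then obtain f where f: "\<And>v. (u, v) \<in> parcs T \<Longrightarrow> (v, f v) \<in> parcs T \<and> f v \<noteq> u" by metis
  let ?P = "f ` N u"
  have P: "?P \<subseteq> V" "u \<notin> ?P" using f arc_in_V by (metis image_subsetI mem_N, metis imageE mem_N)
  have "inj_on c ?P"
  proof (rule inj_onI)
    fix x x' assume "x \<in> ?P" "x' \<in> ?P" and eq: "c x = c x'"
    then obtain v v' where v: "(u, v) \<in> parcs T" "(u, v') \<in> parcs T" "x = f v" "x' = f v'" by auto
    have "x \<in> V" "x' \<in> V" using \<open>x \<in> ?P\<close> \<open>x' \<in> ?P\<close> P by auto
    then obtain w where "C x \<subseteq> N w" using class_in_nbhd by metis
    then have "(w, x) \<in> parcs T" "(w, x') \<in> parcs T"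
      using eq \<open>x \<in> V\<close> \<open>x' \<in> V\<close> by (auto simp: color_class_def)
    \<comment> \<open>A class lies in the neighbourhood of some \<open>w\<close>, so equal colors of
      \<open>f v\<close> and \<open>f v'\<close> with \<open>v \<noteq> v'\<close> would give a
      cycle through \<open>u\<close> and \<open>w\<close>.\<close>
    then have "v = v'" using no_C6[OF v(1,2)] f[OF v(1)] f[OF v(2)] v(3,4) by blast
    then show "x = x'" using v by simp
  qed
  moreover have "c u \<notin> c ` ?P"
  proof
    assume "c u \<in> c ` ?P"
    then obtain x where "x \<in> ?P" "c x = c u" by (metis imageE)
    then have "x \<in> C u" using P by (auto simp: color_class_def)
    then show False using u(2) P(2) \<open>x \<in> ?P\<close> by simp
  qed
  ultimately have "inj_on c (insert u ?P)" using P(2) by simp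
  then obtain v where v: "C u \<subseteq> N v" "N v \<inter> ?P = {}" using class_needed[OF P(1) u(1) P(2)] by metis
  then have "(v, u) \<in> parcs T" using u(2) by simp
  then have "(u, v) \<in> parcs T" by (rule arc_sym)
  then have "f v \<in> N v \<inter> ?P" using f[of v] by simp
  then show False using v by blast
qed

text \<open>Only \<open>z\<close> sees a leaf \<open>l\<close> at \<open>z\<close>, so only
  \<open>z\<close> can dominate the class of \<open>l\<close>, which turns out to be all of
  \<open>N z\<close>. This class is not a singleton: otherwise \<open>l\<close> would be a support
  vertex and the tree would be \<open>P_2\<close>.\<close>

lemma support_nbhd:
  assumes "\<not> is_P2 T" and z: "support_vertex T z" and x: "(z, x) \<in> parcs T"
  shows "C x = N z" "\<not> support_vertex T x" "card (N z) \<ge> 2"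
proof -
  obtain l where l: "(z, l) \<in> parcs T" "leaf T l"
    using z by (auto simp: support_vertex_def)
  then have Nl: "N l = {z}" using leafE arc_sym[OF l(1)] by (metis mem_N singletonD)
  have lV: "l \<in> V" using l by (simp add: leaf_def)
  have only_z: "v = z" if "C l \<subseteq> N v" for v
  proof -
    have "l \<in> N v" using that self_in_class[OF lV] by blast
    then have "(l, v) \<in> parcs T" using arc_sym by simp
    then show ?thesis using Nl by (metis mem_N singletonD)
  qed
  have "C l \<subseteq> N z" using class_in_nbhd[OF lV] only_z by metis
  \<comment> \<open>With \<open>y\<close> in another class, \<open>l\<close> and \<open>y\<close>
    could both be representatives. The vertex that needs \<open>l\<close> would not see
    \<open>y\<close>, but it can only be \<open>z\<close>.\<close>
  moreover have "y \<in> C l" if y: "(z, y) \<in> parcs T" for y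
  proof (rule ccontr)
    assume "y \<notin> C l"
    then have "c y \<noteq> c l" using arc_in_V[OF y] by (auto simp: color_class_def)
    then obtain v where "C l \<subseteq> N v" "N v \<inter> {y} = {}"
      using class_needed[of "{y}" l] lV arc_in_V[OF y] by auto
    then show False using only_z y by auto
  qed
  ultimately have Cl: "C l = N z" by auto
  show Cx: "C x = N z" using class_eq[of x l] Cl x by simp
  have nl: "\<not> support_vertex T l"
  proof
    assume "support_vertex T l"
    then have "leaf T z" using Nl by (auto simp: support_vertex_def)
    then obtain y where "N z = {y}" using leafE by metis
    then have "N z = {l}" using l(1) by (metis mem_N singletonD)
    then show False using P2_if_adjacent_leaves Nl assms(1) by blast
  qed
  have ne: "N z \<noteq> {y}" for y
  proof
    assume "N z = {y}"
    then have "C l = {l}" using Cl self_in_class[OF lV] by (metis singletonD)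
    then show False using singleton_support lV nl by blast
  qed
  show "\<not> support_vertex T x" using ne Cx support_singleton by metis
  have "finite (N z)" using finite_subset[OF _ finite_V, of "N z"] by (auto simp: nbhd_def)
  moreover have "N z \<noteq> {}" using l(1) mem_N by (metis empty_iff)
  ultimately have "card (N z) \<noteq> 0" "card (N z) \<noteq> 1" using ne by (auto simp: card_1_singleton_iff)
  then show "card (N z) \<ge> 2" by linarith
qed

lemma nbhd_eqD:
  assumes "card (N z) \<ge> 2" "N z \<subseteq> N w"
  shows "w = z"
proof -
  obtain a b where "a \<in> N z" "b \<in> N z" "a \<noteq> b"
    using obtain_subset_with_card_n[OF assms(1)] by (metis card_2_iff insert_subset)
  then show ?thesis using no_C4[of w a b z] assms(2) by (metis mem_N subsetD)
qed

text \<open>A vertex \<open>x\<close> of the exceptional set \<open>B\<close> dominates a class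
  containing no support vertex, hence with at least two members. All of them lie in
  \<open>B\<close>, so \<open>B\<close> would have minimum degree two.\<close>

lemma support_dominates:
  assumes "\<not> is_P2 T" "v \<in> V"
  shows "support_vertex T v \<or> (\<exists>z. support_vertex T z \<and> (v, z) \<in> parcs T)"
proof -
  define B where "B = {v \<in> V. \<not> support_vertex T v \<and> \<not> (\<exists>z. support_vertex T z \<and> (v, z) \<in> parcs T)}"
  have "\<exists>y\<in>B. \<exists>z\<in>B. y \<noteq> z \<and> (x, y) \<in> parcs T \<and> (x, z) \<in> parcs T" if x: "x \<in> B" for x
  proof -
    have "x \<in> V" using x by (simp add: B_def)
    then obtain y where y: "y \<in> V" "C y \<subseteq> N x" using td_coloringE[OF coloring] by metis
    then have xy: "(x, y) \<in> parcs T" using self_in_class by fastforce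
    then have "\<not> support_vertex T y" using x by (auto simp: B_def)
    then have "C y \<noteq> {y}" using singleton_support y(1) by blast
    then obtain y' where y': "y' \<in> C y" "y' \<noteq> y" using self_in_class[OF y(1)] by blast
    have "a \<in> B" if a: "a \<in> C y" for a
    proof -
      have xa: "(x, a) \<in> parcs T" using a y(2) by auto
      have "(a, z) \<notin> parcs T" if z: "support_vertex T z" for z
      proof
        assume "(a, z) \<in> parcs T"
        \<comment> \<open>A support vertex \<open>z\<close> next to \<open>a\<close> would make the
          class of \<open>a\<close> equal to \<open>N z\<close>. Then
          \<open>N z \<subseteq> N x\<close> forces \<open>x = z\<close>.\<close>
        then have "C a = N z" "card (N z) \<ge> 2" using support_nbhd[OF assms(1) z] arc_sym by blast+
        then have "x = z" using class_eq[OF a] y(2) nbhd_eqD by metis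
        then show False using x z by (simp add: B_def)
      qed
      moreover have "\<not> support_vertex T a" using x xa by (auto simp: B_def)
      ultimately show ?thesis using arc_in_V[OF xa] by (auto simp: B_def)
    qed
    then show ?thesis using y' y(2) xy self_in_class[OF y(1)] by (metis mem_N subsetD)
  qed
  moreover have "B \<subseteq> V" by (auto simp: B_def)
  ultimately have "B = {}" using no_min_degree_two by metis
  then show ?thesis using assms(2) by (auto simp: B_def)
qed

theorem in_star_family: "T \<in> star_family"
proof (cases "is_P2 T")
  case True
  then show ?thesis by (simp add: star_family_def)
next
  case False
  note nbhd = support_nbhd[OF False]
  show ?thesis
  proof (rule star_familyI)
    show "{z. support_vertex T z} \<subseteq> V" by (auto simp: support_vertex_def)
    show "card (N z) \<ge> 2" if "z \<in> {z. support_vertex T z}" for z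
      using that nbhd(3)[of z] by (auto simp: support_vertex_def)
    show "(z, z') \<notin> parcs T" if "z \<in> {z. support_vertex T z}" "z' \<in> {z. support_vertex T z}" for z z'
      using that nbhd(2)[of z z'] by auto
    fix v assume "v \<in> V - {z. support_vertex T z}"
    then obtain z where z: "support_vertex T z" "(v, z) \<in> parcs T"
      using support_dominates[OF False] by blast
    \<comment> \<open>Both \<open>N z\<close> and \<open>N z'\<close> equal the class of
      \<open>v\<close>, and a neighbourhood with at least two vertices determines its
      center.\<close>
    moreover have "z' = z" if z': "support_vertex T z'" "(v, z') \<in> parcs T" for z'
      using nbhd(1,3)[OF z(1) arc_sym[OF z(2)]] nbhd(1)[OF z'(1) arc_sym[OF z'(2)]] nbhd_eqD
      by (metis subset_refl)
    ultimately show "\<exists>!z. z \<in> {z. support_vertex T z} \<and> (v, z) \<in> parcs T" by blast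
  qed simp
qed

end

theorem theorem4:
  fixes T :: "'a pair_pre_digraph"
  assumes "undirected_tree T"
    and "card (pverts T) \<ge> 2"
    and "T \<notin> star_family"
  shows "td_chromatic_number T = total_domination_number T + 1 \<longleftrightarrow>
    (\<exists>D D1 D2. minimum_td_set T D \<and> D = D1 \<union> D2 \<and> D1 \<inter> D2 = {} \<and>
       D2 \<subseteq> {u \<in> D. card (private_nbhd T u D) = 1} \<and>
       \<not> (\<exists>v \<in> pverts T. card (nbhd T v \<inter> D) \<ge> 2 \<and> nbhd T v \<inter> D \<subseteq> D2) \<and>
       independent_set T
         (pverts T - (D1 \<union> (\<Union>s \<in> (\<Union>v \<in> D2. private_nbhd T v D). closed_nbhd T s))))"
proof -
  interpret undirected_tree_graph T using assms(1,2) by unfold_locales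
  \<comment> \<open>Outside the family the lower bound \<gamma> is strict, so \<gamma> + 1 is
    attained exactly when it is an upper bound.\<close>
  have "td_chromatic_number T \<noteq> \<gamma>"
  proof
    assume eq: "td_chromatic_number T = \<gamma>"
    obtain c where "td_coloring T c" "card (c ` V) = td_chromatic_number T"
      by (rule optimal_td_coloring)
    then interpret tight_td_coloring T c using eq by unfold_locales auto
    show False using in_star_family assms(3) by blast
  qed
  then have "\<gamma> + 1 \<le> td_chromatic_number T" using total_domination_le_td_chromatic by linarith
  then have "td_chromatic_number T = \<gamma> + 1 \<longleftrightarrow> (\<exists>D D1 D2. good_partition D D1 D2)"
    using good_partition_if_coloring coloring_if_good_partition le_antisym by blast
  then show ?thesis unfolding good_partition_def .
qed

end
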